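(* Let $(S,s)$ be a finite bijective set-theoretic solution to the Pentagon Equation and let $(\overline{S},\overline{s})$ be its retract, with $\overline{s}(x,y)=(x\cdot y,\overline{\theta}_x(y))$ for $x,y\in\overline S$. Let $\overline{E}=E(\overline{S},\cdot)$ and $\ker\overline{\theta}=\{x\in\overline{S}:\overline{\theta}_x=\mathrm{id}_{\overline{S}}\}$. Then $|\ker\overline{\theta}\cap\overline{E}|=1$. In particular, $(\overline{S},\overline{s})$ is irretractable.
   Context: A set-theoretic solution to the Pentagon Equation is a pair $(S,s)$ with $S$ a nonempty set and $s:S\times S\to S\times S$ a map such that $s_{23}s_{13}s_{12}=s_{12}s_{23}$ on $S\times S\times S$, where $s_{12}=s\times\mathrm{id}$, $s_{23}=\mathrm{id}\times s$, $s_{13}=(\tau\times\mathrm{id})(\mathrm{id}\times s)(\tau\times\mathrm{id})$ and $\tau(x,y)=(y,x)$. It is finite if $S$ is finite, and bijective if $s$ is bijective. Writing $s(x,y)=(x\cdot y,\theta_x(y))$, $(S,\cdot)$ is a semigroup, and $E(S,\cdot)$ denotes its set of idempotents. For a finite bijective solution, $(S,\cdot)$ is a left group (isomorphic to $E\times G$ with $G$ a group and $(e,g)(f,h)=(e,gh)$). Fix $e_0\in E(S,\cdot)$, put $1=\theta_{e_0}(e_0)$, an idempotent of $(S,\cdot)$, and $G_1=1\cdot S$, a group under $\cdot$. Every element of $S$ is uniquely $e\cdot g$ with $e\in E(S,\cdot)$, $g\in G_1$. Define $e\cdot g\approx f\cdot h$ (for $e,f\in E(S,\cdot)$, $g,h\in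 G_1$) iff $\theta_e=\theta_f$ and $g=h$. The retract of $(S,s)$ is $(\overline{S},\overline{s})$ with $\overline{S}=S/\approx$ and $\overline{s}$ the map induced by $s$ on classes, $\overline s(\overline x,\overline y)=(\overline{x\cdot y},\overline{\theta_x(y)})$; it is again a finite bijective solution. A solution is irretractable if $\overline{S}=S$, i.e. if $\approx$ is the equality relation. *)

theory Defs
  imports Main
begin

text \<open>Maps on triples acting in two of the three positions.\<close>

definition lift12 :: "('a \<times> 'a \<Rightarrow> 'a \<times> 'a) \<Rightarrow> 'a \<times> 'a \<times> 'a \<Rightarrow> 'a \<times> 'a \<times> 'a" where
  "lift12 f = (\<lambda>(x, y, z). case f (x, y) of (a, b) \<Rightarrow> (a, b, z))"

definition lift23 :: "('a \<times> 'a \<Rightarrow> 'a \<times> 'a) \<Rightarrow> 'a \<times> 'a \<times> 'a \<Rightarrow> 'a \<times> 'a \<times> 'a" where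
  "lift23 f = map_prod id f"

definition lift13 :: "('a \<times> 'a \<Rightarrow> 'a \<times> 'a) \<Rightarrow> 'a \<times> 'a \<times> 'a \<Rightarrow> 'a \<times> 'a \<times> 'a" where
  "lift13 f = lift12 prod.swap \<circ> lift23 f \<circ> lift12 prod.swap"

text \<open>
  Solutions live on a carrier set \<open>S\<close>, because the retract is a solution on a set of
  equivalence classes. The values of \<open>s\<close> outside \<open>S \<times> S\<close> are irrelevant.
\<close>

definition pentagon_solution :: "'a set \<Rightarrow> ('a \<times> 'a \<Rightarrow> 'a \<times> 'a) \<Rightarrow> bool" where
  "pentagon_solution S s \<longleftrightarrow>
     S \<noteq> {} \<and> s ` (S \<times> S) \<subseteq> S \<times> S \<and>
     (\<forall>t \<in> S \<times> S \<times> S.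
        (lift23 s \<circ> lift13 s \<circ> lift12 s) t = (lift12 s \<circ> lift23 s) t)"

definition finite_bijective_solution :: "'a set \<Rightarrow> ('a \<times> 'a \<Rightarrow> 'a \<times> 'a) \<Rightarrow> bool" where
  "finite_bijective_solution S s \<longleftrightarrow>
     pentagon_solution S s \<and> finite S \<and> bij_betw s (S \<times> S) (S \<times> S)"

definition pmult :: "('a \<times> 'a \<Rightarrow> 'a \<times> 'a) \<Rightarrow> 'a \<Rightarrow> 'a \<Rightarrow> 'a" where
  "pmult s x y = fst (s (x, y))"

definition theta :: "('a \<times> 'a \<Rightarrow> 'a \<times> 'a) \<Rightarrow> 'a \<Rightarrow> 'a \<Rightarrow> 'a" where
  "theta s x y = snd (s (x, y))"

definition idempotents :: "'a set \<Rightarrow> ('a \<times> 'a \<Rightarrow> 'a \<times> 'a) \<Rightarrow> 'a set" where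
  "idempotents S s = {e \<in> S. pmult s e e = e}"

definition ker_theta :: "'a set \<Rightarrow> ('a \<times> 'a \<Rightarrow> 'a \<times> 'a) \<Rightarrow> 'a set" where
  "ker_theta S s = {x \<in> S. \<forall>y \<in> S. theta s x y = y}"

definition base_one :: "('a \<times> 'a \<Rightarrow> 'a \<times> 'a) \<Rightarrow> 'a \<Rightarrow> 'a" where
  "base_one s e0 = theta s e0 e0"

definition base_group :: "'a set \<Rightarrow> ('a \<times> 'a \<Rightarrow> 'a \<times> 'a) \<Rightarrow> 'a \<Rightarrow> 'a set" where
  "base_group S s e0 = pmult s (base_one s e0) ` S"

text \<open>
  The relation \<open>\<approx>\<close>, for a chosen base idempotent \<open>e0\<close>. The equality \<open>\<theta>\<^sub>e = \<theta>\<^sub>f\<close> is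
  equality of maps on \<open>S\<close>, and the condition \<open>g = h\<close> is expressed by using
  the same \<open>g\<close> in both factorisations.
\<close>

definition retract_rel :: "'a set \<Rightarrow> ('a \<times> 'a \<Rightarrow> 'a \<times> 'a) \<Rightarrow> 'a \<Rightarrow> ('a \<times> 'a) set" where
  "retract_rel S s e0 =
     {(pmult s e g, pmult s f g) | e f g.
        e \<in> idempotents S s \<and> f \<in> idempotents S s \<and> g \<in> base_group S s e0 \<and>
        (\<forall>y \<in> S. theta s e y = theta s f y)}"

definition retract_set :: "'a set \<Rightarrow> ('a \<times> 'a \<Rightarrow> 'a \<times> 'a) \<Rightarrow> 'a \<Rightarrow> 'a set set" where
  "retract_set S s e0 = S // retract_rel S s e0"

text \<open>
  The induced map on classes, in the usual form for quotients: the union of the classes of the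
  results over all representatives. As \<open>\<approx>\<close> is compatible with \<open>s\<close>, this is the class of the
  result for any choice of representatives.
\<close>

definition retract_map ::
  "'a set \<Rightarrow> ('a \<times> 'a \<Rightarrow> 'a \<times> 'a) \<Rightarrow> 'a \<Rightarrow> 'a set \<times> 'a set \<Rightarrow> 'a set \<times> 'a set" where
  "retract_map S s e0 = (\<lambda>(X, Y).
     (\<Union>x\<in>X. \<Union>y\<in>Y. retract_rel S s e0 `` {pmult s x y},
      \<Union>x\<in>X. \<Union>y\<in>Y. retract_rel S s e0 `` {theta s x y}))"

definition irretractable :: "'a set \<Rightarrow> ('a \<times> 'a \<Rightarrow> 'a \<times> 'a) \<Rightarrow> 'a \<Rightarrow> bool" where
  "irretractable S s e0 \<longleftrightarrow> retract_rel S s e0 = Id_on S"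

end

theory Submission
  imports Defs
begin

text \<open>
  Counting with one-sided ideals, for the given product and for that of the dual solution, shows
  that each idempotent of \<open>S\<close> is a right identity. Comparing the pairs \<open>s(x, y)\<close> then yields that
  every \<open>\<theta>\<^sub>x\<close> is bijective. The identity \<open>\<theta>\<^bsub>\<theta>\<^sub>e(h)\<^esub> \<theta>\<^sub>e = \<theta>\<^sub>h\<close> for idempotents \<open>e, h\<close> does the rest: for
  \<open>h = e\<close> it gives \<open>\<theta>\<^sub>1 = id\<close>; and if \<open>\<theta>\<^sub>e(h) \<approx> \<theta>\<^sub>f(h)\<close>, then \<open>\<theta>\<^bsub>\<theta>\<^sub>e(h)\<^esub> = \<theta>\<^bsub>\<theta>\<^sub>f(h)\<^esub>\<close>, so cancelling this
  bijection gives \<open>\<theta>\<^sub>e = \<theta>\<^sub>f\<close>. Thus idempotents with the same \<open>\<theta>\<close> in the retract coincide.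
\<close>

lemma finite_inj_on_preimage_mem:
  assumes "inj_on f D" "finite D" "A \<subseteq> D" "f ` A \<subseteq> B" "card A = card B" "finite B"
    and "p \<in> D" "f p \<in> B"
  shows "p \<in> A"
proof -
  have "card (f ` A) = card B"
    using assms by (metis card_image inj_on_subset)
  then have "f ` A = B"
    using assms by (metis card_subset_eq)
  then show ?thesis
    using assms by (metis inj_on_image_mem_iff)
qed

section \<open>Basic identities of a finite bijective solution\<close>

locale finite_pentagon =
  fixes S :: "'a set" and s :: "'a \<times> 'a \<Rightarrow> 'a \<times> 'a"
  assumes sol: "finite_bijective_solution S s"
begin

abbreviation mult (infixl "\<cdot>" 70) where "x \<cdot> y \<equiv> pmult s x y"
abbreviation \<theta> where "\<theta> \<equiv> theta s"
abbreviation E where "E \<equiv> idempotents S s"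

lemma s_eq: "s (x, y) = (x \<cdot> y, \<theta> x y)"
  by (simp add: pmult_def theta_def)

lemma finite_S: "finite S"
  using sol by (simp add: finite_bijective_solution_def)

lemma bij_s: "bij_betw s (S \<times> S) (S \<times> S)"
  using sol by (simp add: finite_bijective_solution_def)

lemma s_mem: "x \<in> S \<Longrightarrow> y \<in> S \<Longrightarrow> s (x, y) \<in> S \<times> S"
  using bij_s by (auto simp: bij_betw_def)

lemma mult_closed [simp, intro]: "x \<in> S \<Longrightarrow> y \<in> S \<Longrightarrow> x \<cdot> y \<in> S"
  using s_mem[of x y] by (simp add: s_eq)

lemma theta_closed [simp, intro]: "x \<in> S \<Longrightarrow> y \<in> S \<Longrightarrow> \<theta> x y \<in> S"
  using s_mem[of x y] by (simp add: s_eq)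

lemma s_inj:
  assumes "x \<cdot> y = x' \<cdot> y'" "\<theta> x y = \<theta> x' y'" "x \<in> S" "y \<in> S" "x' \<in> S" "y' \<in> S"
  shows "x = x' \<and> y = y'"
proof -
  have "inj_on s (S \<times> S)" using bij_s by (simp add: bij_betw_def)
  then have "(x, y) = (x', y')"
    by (rule inj_onD) (use assms in \<open>auto simp: s_eq\<close>)
  then show ?thesis by simp
qed

lemma s_surj:
  assumes "a \<in> S" "b \<in> S"
  obtains x y where "x \<in> S" "y \<in> S" "x \<cdot> y = a" "\<theta> x y = b"
proof -
  have "(a, b) \<in> s ` (S \<times> S)" using bij_s assms by (simp add: bij_betw_def)
  then obtain x y where "x \<in> S" "y \<in> S" "(a, b) = s (x, y)" by auto
  then show ?thesis using that by (simp add: s_eq)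
qed

lemma pentagon:
  assumes "x \<in> S" "y \<in> S" "z \<in> S"
  shows "((x \<cdot> y) \<cdot> z, \<theta> x y \<cdot> \<theta> (x \<cdot> y) z, \<theta> (\<theta> x y) (\<theta> (x \<cdot> y) z))
       = (x \<cdot> (y \<cdot> z), \<theta> x (y \<cdot> z), \<theta> y z)"
proof -
  have "(lift23 s \<circ> lift13 s \<circ> lift12 s) (x, y, z) = (lift12 s \<circ> lift23 s) (x, y, z)"
    using sol assms by (simp add: finite_bijective_solution_def pentagon_solution_def)
  then show ?thesis
    by (simp add: lift23_def lift13_def lift12_def s_eq)
qed

lemma assoc: "x \<in> S \<Longrightarrow> y \<in> S \<Longrightarrow> z \<in> S \<Longrightarrow> (x \<cdot> y) \<cdot> z = x \<cdot> (y \<cdot> z)"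
  and theta_mult: "x \<in> S \<Longrightarrow> y \<in> S \<Longrightarrow> z \<in> S \<Longrightarrow> \<theta> x (y \<cdot> z) = \<theta> x y \<cdot> \<theta> (x \<cdot> y) z"
  and theta_theta: "x \<in> S \<Longrightarrow> y \<in> S \<Longrightarrow> z \<in> S \<Longrightarrow> \<theta> (\<theta> x y) (\<theta> (x \<cdot> y) z) = \<theta> y z"
  using pentagon by auto

section \<open>The dual product and one-sided ideals\<close>

text \<open>
  The product of the dual solution \<open>\<tau> s\<^sup>-\<^sup>1 \<tau>\<close>, with its arguments swapped; hence it is associative.
\<close>

definition dual (infixl "\<star>" 70) where
  "a \<star> b = snd (inv_into (S \<times> S) s (a, b))"

lemma dual_eq: "x \<in> S \<Longrightarrow> y \<in> S \<Longrightarrow> (x \<cdot> y) \<star> \<theta> x y = y"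
  using bij_s by (simp add: dual_def flip: s_eq) (simp add: bij_betw_def)

lemma dual_closed [simp, intro]:
  assumes "a \<in> S" "b \<in> S" shows "a \<star> b \<in> S"
  by (metis assms dual_eq s_surj)

lemma dual_assoc:
  assumes "a \<in> S" "b \<in> S" "c \<in> S"
  shows "(a \<star> b) \<star> c = a \<star> (b \<star> c)"
proof -
  \<comment> \<open>Both sides of the pentagon equation send the triple \<open>(x, y, z)\<close>
    found here to \<open>(a, b, c)\<close>; each bracketing then recovers \<open>z\<close>.\<close>
  obtain x p where xp: "x \<in> S" "p \<in> S" "x \<cdot> p = a" "\<theta> x p = b"
    using assms s_surj by metis
  obtain y z where yz: "y \<in> S" "z \<in> S" "y \<cdot> z = p" "\<theta> y z = c"
    using assms xp s_surj by metis
  have "a \<star> b = y \<cdot> z" using xp yz dual_eq by metis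
  then have 1: "(a \<star> b) \<star> c = z" using yz dual_eq by metis
  have b: "b = \<theta> x y \<cdot> \<theta> (x \<cdot> y) z" using xp yz theta_mult by metis
  have c: "c = \<theta> (\<theta> x y) (\<theta> (x \<cdot> y) z)" using xp yz theta_theta by metis
  have "b \<star> c = \<theta> (x \<cdot> y) z" unfolding b c using xp yz by (simp add: dual_eq)
  moreover have "a = (x \<cdot> y) \<cdot> z" using xp yz assoc by metis
  ultimately have "a \<star> (b \<star> c) = z" using xp yz by (simp add: dual_eq)
  then show ?thesis using 1 by simp
qed

text \<open>
  As \<open>|S \<times> L| = |L \<times> S|\<close>, the injection \<open>s\<close> maps \<open>S \<times> L\<close> onto \<open>L \<times> S\<close>. So every
  preimage under \<open>s\<close> of a pair in \<open>L \<times> S\<close> has its second entry in \<open>L\<close>.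
\<close>

lemma left_ideal_mem:
  assumes L: "L \<subseteq> S" "\<And>x y. x \<in> S \<Longrightarrow> y \<in> L \<Longrightarrow> x \<cdot> y \<in> L"
    and "x \<in> S" "y \<in> S" "x \<cdot> y \<in> L"
  shows "y \<in> L"
proof -
  have "(x, y) \<in> S \<times> L"
  proof (rule finite_inj_on_preimage_mem[where f = s and D = "S \<times> S" and B = "L \<times> S"])
    show "inj_on s (S \<times> S)" using bij_s by (simp add: bij_betw_def)
    show "s ` (S \<times> L) \<subseteq> L \<times> S" using L by (auto simp: s_eq)
    show "finite (L \<times> S)" using L finite_S finite_subset by blast
    show "card (S \<times> L) = card (L \<times> S)" by (simp add: card_cartesian_product)
  qed (use assms finite_S in \<open>auto simp: s_eq\<close>)
  then show ?thesis by simp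
qed

text \<open>For a right ideal, \<open>s\<close> maps the finite set \<open>I \<times> S\<close>
  injectively into itself, hence permutes it.\<close>

lemma right_ideal_mem:
  assumes I: "I \<subseteq> S" "\<And>x y. x \<in> I \<Longrightarrow> y \<in> S \<Longrightarrow> x \<cdot> y \<in> I"
    and "x \<in> S" "y \<in> S" "x \<cdot> y \<in> I"
  shows "x \<in> I"
proof -
  have "(x, y) \<in> I \<times> S"
  proof (rule finite_inj_on_preimage_mem[where f = s and D = "S \<times> S" and B = "I \<times> S"])
    show "inj_on s (S \<times> S)" using bij_s by (simp add: bij_betw_def)
    show "s ` (I \<times> S) \<subseteq> I \<times> S" using I by (auto simp: s_eq)
    show "finite (I \<times> S)" using I finite_S finite_subset by blast
  qed (use assms finite_S in \<open>auto simp: s_eq\<close>)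
  then show ?thesis by simp
qed

text \<open>The second entry of the inverse of \<open>s\<close> at \<open>(x, y)\<close> is
  \<open>x \<star> y\<close>, so this inverse permutes \<open>S \<times> L\<close>.\<close>

lemma dual_left_ideal_mem:
  assumes L: "L \<subseteq> S" "\<And>x y. x \<in> S \<Longrightarrow> y \<in> L \<Longrightarrow> x \<star> y \<in> L"
    and ab: "a \<in> S" "b \<in> S" "a \<star> b \<in> L"
  shows "b \<in> L"
proof -
  let ?r = "inv_into (S \<times> S) s"
  have bij: "bij_betw ?r (S \<times> S) (S \<times> S)" using bij_s by (rule bij_betw_inv_into)
  have r: "?r p \<in> S \<times> S" if "p \<in> S \<times> S" for p
    using bij that bij_betwE by blast
  have "(a, b) \<in> S \<times> L"
  proof (rule finite_inj_on_preimage_mem[where f = ?r and D = "S \<times> S" and B = "S \<times> L"])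
    show "inj_on ?r (S \<times> S)" using bij by (simp add: bij_betw_def)
    show "?r ` (S \<times> L) \<subseteq> S \<times> L"
    proof clarify
      fix x y p q assume *: "x \<in> S" "y \<in> L" "(p, q) = ?r (x, y)"
      then have "x \<star> y = q" unfolding dual_def by (metis snd_conv)
      then have "q \<in> L" using * L by blast
      moreover have "(p, q) \<in> S \<times> S" using * L r by (metis mem_Sigma_iff subsetD)
      ultimately show "p \<in> S \<and> q \<in> L" by simp
    qed
    show "finite (S \<times> L)" using L finite_S finite_subset by blast
    show "?r (a, b) \<in> S \<times> L"
      using ab r[of "(a, b)"] by (auto simp: dual_def mem_Times_iff)
  qed (use L ab finite_S in auto)
  then show ?thesis by simp
qed

lemma E_in_S: "e \<in> E \<Longrightarrow> e \<in> S" and E_idem: "e \<in> E \<Longrightarrow> e \<cdot> e = e"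
  by (auto simp: idempotents_def)

text \<open>
  Both \<open>a = \<theta>\<^sub>e(f)\<close> and \<open>q = \<theta>\<^sub>f(f)\<close> satisfy \<open>f \<star> a = f = f \<star> q\<close>, so \<open>q\<close> lies in the left ideal
  \<open>S \<star> f\<close>, on which \<open>a\<close> acts trivially from the right; this forces \<open>a = q\<close>.
\<close>

lemma right_zero_idempotents_eq:
  assumes "e \<in> E" "f \<in> E" and ef: "e \<cdot> f = f" and fe: "f \<cdot> e = e"
  shows "e = f"
proof -
  note S = E_in_S[OF assms(1)] E_in_S[OF assms(2)]
  note ee = E_idem[OF assms(1)] and ff = E_idem[OF assms(2)]
  define a q where "a = \<theta> e f" and "q = \<theta> f f"
  have aS: "a \<in> S" "q \<in> S" using S by (auto simp: a_def q_def)
  have q: "q \<cdot> q = q" using theta_mult[of f f f] S ff by (simp add: q_def)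
  have aq: "a \<cdot> q = a" using theta_mult[of e f f] S ff ef by (simp add: q_def a_def)
  have taq: "\<theta> a q = q" using theta_theta[of e f f] S ff ef by (simp add: q_def a_def)
  have ba: "\<theta> f e \<cdot> a = q" using theta_mult[of f e f] S ef fe by (simp add: q_def a_def)
  have tba: "\<theta> (\<theta> f e) a = a" using theta_theta[of f e f] S ef fe by (simp add: a_def)
  have 1: "f \<star> a = f" using dual_eq[of e f] S ef by (simp add: a_def)
  have 2: "f \<star> q = f" using dual_eq[of f f] S ff by (simp add: q_def)
  have 3: "q \<star> a = a" using dual_eq[of "\<theta> f e" a] S aS ba tba by simp
  define L where "L = (\<lambda>x. x \<star> f) ` S"
  have LS: "L \<subseteq> S" using S by (auto simp: L_def)
  have Lc: "x \<star> y \<in> L" if "x \<in> S" "y \<in> L" for x y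
  proof -
    obtain u where "u \<in> S" "y = u \<star> f" using \<open>y \<in> L\<close> by (auto simp: L_def)
    then have "x \<star> y = (x \<star> u) \<star> f" "x \<star> u \<in> S" using that S dual_assoc by auto
    then show ?thesis by (auto simp: L_def)
  qed
  \<comment> \<open>Only \<open>f \<star> f\<close> visibly lies in \<open>S \<star> f\<close>; the
    ideal property descends from it to \<open>f\<close>, then from \<open>f = f \<star> q\<close> to
    \<open>q\<close>.\<close>
  have "f \<star> f \<in> L" using S by (auto simp: L_def)
  then have "f \<in> L" using dual_left_ideal_mem[OF LS Lc] S by blast
  then have "q \<in> L" using dual_left_ideal_mem[OF LS Lc, of f q] S aS 2 by simp
  then obtain x where x: "x \<in> S" "q = x \<star> f" by (auto simp: L_def)
  have "q \<star> a = q" using dual_assoc[of x f a] x S aS 1 by simp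
  then have "a = q" using 3 by simp
  \<comment> \<open>Now \<open>s\<close> sends both \<open>(e, f)\<close> and \<open>(f, f)\<close>
    to \<open>(f, q)\<close>.\<close>
  then show ?thesis using s_inj[of e f f f] S ef ff by (simp add: a_def q_def)
qed

section \<open>The left group structure\<close>

lemma mem_right_ideal:
  assumes "x \<in> S" "y \<in> S" obtains u where "u \<in> S" "x = x \<cdot> y \<cdot> u"
proof -
  let ?I = "(\<lambda>u. x \<cdot> y \<cdot> u) ` S"
  have "x \<in> ?I"
  proof (rule right_ideal_mem)
    show "a \<cdot> b \<in> ?I" if "a \<in> ?I" "b \<in> S" for a b
      using that assms by (auto simp: assoc intro!: image_eqI[where x = "_ \<cdot> b"])
    \<comment> \<open>This element of the right ideal has \<open>x\<close> as its left
      factor.\<close>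
    show "x \<cdot> (y \<cdot> y) \<in> ?I" using assms assoc by auto
  qed (use assms in auto)
  then show ?thesis using that by blast
qed

lemma mem_left_ideal:
  assumes "x \<in> S" "y \<in> S" obtains u where "u \<in> S" "y = u \<cdot> (x \<cdot> y)"
proof -
  let ?L = "(\<lambda>u. u \<cdot> (x \<cdot> y)) ` S"
  have "y \<in> ?L"
  proof (rule left_ideal_mem)
    show "b \<cdot> a \<in> ?L" if "b \<in> S" "a \<in> ?L" for a b
      using that assms by (auto simp: assoc[symmetric] intro!: image_eqI[where x = "b \<cdot> _"])
    show "(x \<cdot> x) \<cdot> y \<in> ?L" using assms assoc by auto
  qed (use assms in auto)
  then show ?thesis using that by blast
qed

text \<open>From \<open>x \<in> x \<cdot> x \<cdot> S\<close> and
  \<open>x \<in> S \<cdot> x \<cdot> x\<close> it follows that \<open>x\<close> lies in a subgroup;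
  \<open>e\<close> is its identity.\<close>

lemma completely_regular:
  assumes "x \<in> S"
  obtains e u v where "e \<in> E" "u \<in> S" "v \<in> S" "x \<cdot> u = e" "v \<cdot> x = e" "e \<cdot> x = x" "x \<cdot> e = x"
proof -
  obtain u where u: "u \<in> S" "x = x \<cdot> x \<cdot> u" using mem_right_ideal assms by metis
  obtain v where v: "v \<in> S" "x = v \<cdot> (x \<cdot> x)" using mem_left_ideal assms by metis
  have vx: "v \<cdot> x = x \<cdot> u"
  proof -
    \<comment> \<open>The product \<open>v \<cdot> x \<cdot> x \<cdot> u\<close> is bracketed in two
      ways.\<close>
    have "v \<cdot> (x \<cdot> x \<cdot> u) = v \<cdot> (x \<cdot> x) \<cdot> u" using assms u(1) v(1) by (simp add: assoc)
    then show ?thesis by (simp flip: u(2) v(2))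
  qed
  have xe: "x \<cdot> (x \<cdot> u) = x" using u assms assoc by metis
  have ex: "(x \<cdot> u) \<cdot> x = x" using v assms assoc vx by metis
  have "x \<cdot> u \<in> E" using ex u assms by (simp add: idempotents_def) (metis assoc mult_closed)
  then show ?thesis using that u v vx xe ex by metis
qed

text \<open>The local identity \<open>h\<close> of \<open>e \<cdot> f\<close> generates the same
  right ideal as \<open>e\<close>, so the two coincide. Then
  \<open>e \<cdot> f = v \<cdot> (e \<cdot> f) \<cdot> f = e\<close>.\<close>

lemma idempotent_left_zero:
  assumes e: "e \<in> E" and f: "f \<in> E" shows "e \<cdot> f = e"
proof -
  note S = E_in_S[OF e] E_in_S[OF f]
  obtain h u v where h: "h \<in> E" "u \<in> S" "v \<in> S" "(e \<cdot> f) \<cdot> u = h" "v \<cdot> (e \<cdot> f) = h"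
    "h \<cdot> (e \<cdot> f) = e \<cdot> f"
    using completely_regular[of "e \<cdot> f"] S mult_closed by metis
  have eh: "e \<cdot> h = h" using h S E_idem[OF e] assoc by (metis mult_closed)
  obtain w where w: "w \<in> S" "e = e \<cdot> f \<cdot> w" using mem_right_ideal S by metis
  have he: "h \<cdot> e = e" using h w S assoc E_in_S by (metis mult_closed)
  have "e = h" using right_zero_idempotents_eq[OF e h(1) eh he] .
  then show ?thesis using h S E_idem[OF f] assoc by (metis mult_closed)
qed

text \<open>With \<open>e\<close> the local identity of \<open>x\<close>,
  \<open>x \<cdot> f = x \<cdot> (e \<cdot> f) = x \<cdot> e = x\<close>.\<close>

lemma mult_idempotent:
  assumes "x \<in> S" "f \<in> E" shows "x \<cdot> f = x"
  using assms completely_regular[OF assms(1)] idempotent_left_zero assoc E_in_S by metis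

lemma right_inverse:
  assumes "x \<in> S" obtains u where "u \<in> S" "x \<cdot> u \<in> E"
  using completely_regular[OF assms] by metis

lemma right_cancel:
  assumes "x \<cdot> z = y \<cdot> z" "x \<in> S" "y \<in> S" "z \<in> S" shows "x = y"
proof -
  obtain u where "u \<in> S" "z \<cdot> u \<in> E" using right_inverse assms by metis
  then show ?thesis using assms mult_idempotent assoc by metis
qed

text \<open>The hypothesis says that \<open>y\<close> and \<open>z\<close> have the same group
  component, a condition independent of \<open>c\<close>.\<close>

lemma left_equivalent_cancel:
  assumes "c \<cdot> y = c \<cdot> z" "c \<in> S" "y \<in> S" "z \<in> S" "d \<in> S" shows "d \<cdot> y = d \<cdot> z"
proof -
  obtain e v where e: "e \<in> E" "v \<in> S" "v \<cdot> c = e" using completely_regular assms(2) by metis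
  have "e \<cdot> y = e \<cdot> z" using e assms assoc by metis
  then show ?thesis using e assms assoc mult_idempotent E_in_S by metis
qed

section \<open>Idempotent factors and bijectivity of the maps \<theta>\<close>

definition idem_part where "idem_part x = (SOME e. e \<in> E \<and> e \<cdot> x = x)"

lemma idem_part:
  assumes "x \<in> S" shows "idem_part x \<in> E" "idem_part x \<cdot> x = x"
  using someI_ex[of "\<lambda>e. e \<in> E \<and> e \<cdot> x = x"] completely_regular[OF assms]
  unfolding idem_part_def by metis+

lemma idem_part_in_S [simp]: "x \<in> S \<Longrightarrow> idem_part x \<in> S"
  using idem_part E_in_S by blast

lemma idem_part_eqI: "e \<in> E \<Longrightarrow> x \<in> S \<Longrightarrow> e \<cdot> x = x \<Longrightarrow> idem_part x = e"
  using right_cancel idem_part E_in_S by metis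

lemma idem_part_mult: "x \<in> S \<Longrightarrow> y \<in> S \<Longrightarrow> idem_part (x \<cdot> y) = idem_part x"
  by (intro idem_part_eqI) (auto simp: idem_part simp flip: assoc)

lemma theta_idempotent:
  assumes "x \<in> S" "f \<in> E" shows "\<theta> x f \<in> E"
  using theta_mult[of x f f] assms E_in_S[OF assms(2)] E_idem[OF assms(2)] mult_idempotent[OF assms]
  by (auto simp: idempotents_def)

text \<open>Here and in the next lemma, \<open>x \<cdot> f = x\<close> removes the shift of index in
  the pentagon identities.\<close>

lemma theta_idempotent_mult:
  assumes "x \<in> S" "f \<in> E" "y \<in> S" shows "\<theta> x (f \<cdot> y) = \<theta> x f \<cdot> \<theta> x y"
  using theta_mult[of x f y] assms mult_idempotent E_in_S by simp

lemma theta_theta_idempotent: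
  assumes "x \<in> S" "f \<in> E" "y \<in> S" shows "\<theta> (\<theta> x f) (\<theta> x y) = \<theta> f y"
  using theta_theta[of x f y] assms mult_idempotent E_in_S by simp

lemma idem_part_theta:
  assumes "x \<in> S" "y \<in> S" shows "idem_part (\<theta> x y) = \<theta> x (idem_part y)"
  using theta_idempotent_mult[of x "idem_part y" y] assms idem_part[of y] theta_idempotent
  by (intro idem_part_eqI) auto

text \<open>As \<open>s (x, f) = (x, \<theta> x f)\<close> for idempotent \<open>f\<close>,
  injectivity of \<open>s\<close> passes to \<open>\<theta> x\<close> on \<open>E\<close>.\<close>

lemma bij_theta_idempotents:
  assumes "x \<in> S" shows "bij_betw (\<theta> x) E E"
proof -
  have "inj_on (\<theta> x) E"
    by (rule inj_onI) (use assms s_inj[of x _ x] E_in_S mult_idempotent in metis)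
  moreover have "finite E" using finite_S by (auto simp: idempotents_def)
  moreover have "\<theta> x ` E \<subseteq> E" using assms theta_idempotent by auto
  ultimately show ?thesis by (simp add: bij_betw_def endo_inj_surj)
qed

text \<open>Second entries are built for which \<open>e \<cdot> y\<close> and
  \<open>e \<cdot> z\<close>, as first entries, give the same value of \<open>s\<close>.\<close>

lemma theta_idempotent_left_inj:
  assumes e: "e \<in> E" and yz: "y \<in> S" "z \<in> S" and eq: "e \<cdot> \<theta> e y = e \<cdot> \<theta> e z"
  shows "e \<cdot> y = e \<cdot> z"
proof -
  note eS = E_in_S[OF e]
  obtain u where u: "u \<in> S" "y \<cdot> u \<in> E" using right_inverse yz by metis
  obtain v where v: "v \<in> S" "z \<cdot> v \<in> E" using right_inverse yz by metis
  let ?a = "\<theta> e y" and ?b = "\<theta> e z" and ?p = "\<theta> (e \<cdot> y) u" and ?q = "\<theta> (e \<cdot> z) v"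
  \<comment> \<open>These are \<open>\<theta> e (y \<cdot> u)\<close> and
    \<open>\<theta> e (z \<cdot> v)\<close>, images of idempotents.\<close>
  have "?a \<cdot> ?p \<in> E" "?b \<cdot> ?q \<in> E"
    using theta_idempotent[OF eS u(2)] theta_idempotent[OF eS v(2)] theta_mult eS yz u v by auto
  then have "e \<cdot> ?a \<cdot> ?p = e \<cdot> ?b \<cdot> ?q"
    using eS yz u v by (simp add: assoc idempotent_left_zero[OF e])
  then have "(e \<cdot> ?a) \<cdot> ?p = (e \<cdot> ?a) \<cdot> ?q" using eq by simp
  then have pq: "e \<cdot> ?p = e \<cdot> ?q"
    using left_equivalent_cancel[of "e \<cdot> ?a" ?p ?q e] eS yz u v by simp
  \<comment> \<open>The factors \<open>f\<close> and \<open>g\<close> adjust \<open>u\<close> and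
    \<open>v\<close> so that the images become \<open>e \<cdot> ?p\<close> and
    \<open>e \<cdot> ?q\<close>, which agree.\<close>
  obtain f where f: "f \<in> E" "\<theta> (e \<cdot> y) f = e"
    using bij_theta_idempotents[of "e \<cdot> y"] eS yz e by (metis bij_betw_def imageE mult_closed)
  obtain g where g: "g \<in> E" "\<theta> (e \<cdot> z) g = e"
    using bij_theta_idempotents[of "e \<cdot> z"] eS yz e by (metis bij_betw_def imageE mult_closed)
  note fg = E_in_S[OF f(1)] E_in_S[OF g(1)]
  have "\<theta> (e \<cdot> y) (f \<cdot> u) = \<theta> (e \<cdot> z) (g \<cdot> v)"
    using theta_idempotent_mult[of "e \<cdot> y" f u] theta_idempotent_mult[of "e \<cdot> z" g v] f g pq eS yz u v
    by simp
  moreover have "e \<cdot> y \<cdot> (f \<cdot> u) = e \<cdot> z \<cdot> (g \<cdot> v)"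
  proof -
    have "e \<cdot> y \<cdot> (f \<cdot> u) = e \<cdot> ((y \<cdot> f) \<cdot> u)" using eS yz fg u by (simp add: assoc)
    also have "\<dots> = e \<cdot> ((z \<cdot> g) \<cdot> v)"
      using mult_idempotent yz f g u v idempotent_left_zero[OF e] by simp
    also have "\<dots> = e \<cdot> z \<cdot> (g \<cdot> v)" using eS yz fg v by (simp add: assoc)
    finally show ?thesis .
  qed
  ultimately show ?thesis using s_inj[of "e \<cdot> y" "f \<cdot> u" "e \<cdot> z" "g \<cdot> v"] eS yz fg u v by simp
qed

lemma bij_theta:
  assumes x: "x \<in> S" shows "bij_betw (\<theta> x) S S"
proof -
  have "inj_on (\<theta> x) S"
  proof (rule inj_onI)
    fix y z assume yz: "y \<in> S" "z \<in> S" and eq: "\<theta> x y = \<theta> x z"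
    have "\<theta> x (idem_part y) = \<theta> x (idem_part z)"
      using idem_part_theta x yz eq by metis
    then have idem: "idem_part y = idem_part z"
      using bij_theta_idempotents[OF x] idem_part yz by (metis bij_betw_def inj_onD)
    let ?e = "idem_part x"
    have e: "?e \<in> E" "?e \<in> S" "?e \<cdot> x = x" using idem_part x by auto
    \<comment> \<open>By \<open>theta_mult\<close>, \<open>\<theta> ?e (x \<cdot> y) = \<theta> ?e x
      \<cdot> \<theta> x y\<close>, which reduces the group component to an idempotent
      index.\<close>
    have "\<theta> ?e (x \<cdot> y) = \<theta> ?e (x \<cdot> z)" using theta_mult[of ?e x] e x yz eq by simp
    then have "?e \<cdot> (x \<cdot> y) = ?e \<cdot> (x \<cdot> z)" 
      using theta_idempotent_left_inj[OF e(1), of "x \<cdot> y" "x \<cdot> z"] x yz by simp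
    then have "x \<cdot> y = x \<cdot> z" using e x yz by (simp flip: assoc)
    then have "idem_part y \<cdot> y = idem_part y \<cdot> z"
      using left_equivalent_cancel[of x y z "idem_part y"] x yz by simp
    then show "y = z" using idem idem_part yz by metis
  qed
  moreover have "\<theta> x ` S \<subseteq> S" using x by auto
  ultimately show ?thesis using finite_S by (simp add: bij_betw_def endo_inj_surj)
qed

lemma theta_surj: "x \<in> S \<Longrightarrow> z \<in> S \<Longrightarrow> \<exists>y\<in>S. z = \<theta> x y"
  using bij_betw_imp_surj_on[OF bij_theta, of x] by blast

lemma theta_inj: "\<theta> x y = \<theta> x z \<Longrightarrow> x \<in> S \<Longrightarrow> y \<in> S \<Longrightarrow> z \<in> S \<Longrightarrow> y = z"
  using bij_betw_imp_inj_on[OF bij_theta, of x] by (blast dest: inj_onD)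

end

section \<open>The retract relation is a congruence\<close>

locale finite_pentagon_retract = finite_pentagon +
  fixes e0
  assumes e0: "e0 \<in> idempotents S s"
begin

abbreviation one ("\<one>") where "\<one> \<equiv> base_one s e0"
abbreviation R where "R \<equiv> retract_rel S s e0"
abbreviation cls where "cls x \<equiv> R `` {x}"
abbreviation S' where "S' \<equiv> retract_set S s e0"
abbreviation s' where "s' \<equiv> retract_map S s e0"

lemma one_E: "\<one> \<in> E"
  using e0 E_in_S theta_idempotent by (simp add: base_one_def)

lemma one_S [simp]: "\<one> \<in> S"
  using one_E E_in_S by blast

lemma theta_one:
  assumes "y \<in> S" shows "\<theta> \<one> y = y"
proof -
  note S = E_in_S[OF e0]
  obtain z where z: "z \<in> S" "y = \<theta> e0 z" using theta_surj[OF S assms] by blast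
  then show ?thesis using theta_theta_idempotent[OF S e0] by (simp add: base_one_def)
qed

text \<open>
  The factors of \<open>x = e \<cdot> g\<close> are \<open>e = idem_part x\<close> and \<open>g = \<one> \<cdot> x\<close>.
\<close>

lemma retract_rel_iff:
  "(x, y) \<in> R \<longleftrightarrow> x \<in> S \<and> y \<in> S \<and> \<one> \<cdot> x = \<one> \<cdot> y
     \<and> (\<forall>z\<in>S. \<theta> (idem_part x) z = \<theta> (idem_part y) z)" (is "_ \<longleftrightarrow> ?rhs")
proof
  assume "(x, y) \<in> R"
  then obtain e f g where x: "x = e \<cdot> g" and y: "y = f \<cdot> g" and ef: "e \<in> E" "f \<in> E"
    and g: "g \<in> base_group S s e0" and eq: "\<forall>z\<in>S. \<theta> e z = \<theta> f z"
    unfolding retract_rel_def by blast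
  have gS: "g \<in> S" using g by (auto simp: base_group_def)
  note S = E_in_S[OF ef(1)] E_in_S[OF ef(2)]
  have "idem_part x = e" "idem_part y = f"
    using idem_part_eqI ef S gS E_idem x y by (metis assoc mult_closed)+
  moreover have "\<one> \<cdot> x = \<one> \<cdot> y"
    using S gS ef x y one_E by (simp add: mult_idempotent flip: assoc)
  ultimately show ?rhs using S gS x y eq by simp
next
  assume r: ?rhs
  have fac: "idem_part z \<cdot> (\<one> \<cdot> z) = z" if "z \<in> S" for z
    using that idem_part one_E by (simp add: mult_idempotent flip: assoc)
  have "x = idem_part x \<cdot> (\<one> \<cdot> x)" "y = idem_part y \<cdot> (\<one> \<cdot> x)"
    using fac r by metis+
  moreover have "\<one> \<cdot> x \<in> base_group S s e0" using r by (simp add: base_group_def)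
  moreover have "idem_part x \<in> E" "idem_part y \<in> E" using r idem_part by auto
  ultimately show "(x, y) \<in> R" unfolding retract_rel_def using r by blast
qed

lemma equiv_retract_rel: "equiv S R"
  by (rule equivI) (auto simp: refl_on_def sym_def trans_def retract_rel_iff)

lemma cls_eq_iff: "x \<in> S \<Longrightarrow> y \<in> S \<Longrightarrow> cls x = cls y \<longleftrightarrow> (x, y) \<in> R"
  using eq_equiv_class_iff[OF equiv_retract_rel] by blast

text \<open>For \<open>x = e \<cdot> g\<close> and \<open>x' = f \<cdot> g\<close>, composing with
  the common bijection \<open>\<theta> (\<theta> e g)\<close> turns both maps into
  \<open>\<theta> g\<close>.\<close>

lemma theta_cong:
  assumes "(x, x') \<in> R" "y \<in> S" shows "\<theta> x y = \<theta> x' y"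
proof -
  let ?e = "idem_part x" and ?f = "idem_part x'" and ?g = "\<one> \<cdot> x"
  have xS: "x \<in> S" "x' \<in> S" using assms by (auto simp: retract_rel_iff)
  have g: "?g = \<one> \<cdot> x'" "?g \<in> S" using assms xS by (auto simp: retract_rel_iff)
  have e: "?e \<cdot> ?g = x" and f: "?f \<cdot> ?g = x'"
    using idem_part[OF xS(1)] idem_part[OF xS(2)] one_E xS mult_idempotent
    by (simp flip: assoc, simp add: g(1) flip: assoc)
  have ef: "\<theta> ?e ?g = \<theta> ?f ?g" using assms g by (auto simp: retract_rel_iff)
  have "\<theta> (\<theta> ?e ?g) (\<theta> x y) = \<theta> (\<theta> ?e ?g) (\<theta> x' y)"
    using theta_theta[of ?e ?g y] theta_theta[of ?f ?g y] e f ef xS g assms by simp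
  then show ?thesis using theta_inj[of "\<theta> ?e ?g" "\<theta> x y" "\<theta> x' y"] xS g assms by simp
qed

lemma mult_retract_rel:
  assumes "(x, x') \<in> R" "(y, y') \<in> R" shows "(x \<cdot> y, x' \<cdot> y') \<in> R"
proof -
  have S: "x \<in> S" "x' \<in> S" "y \<in> S" "y' \<in> S" using assms by (auto simp: retract_rel_iff)
  have "x' \<cdot> y = x' \<cdot> y'"
    using left_equivalent_cancel[of \<one> y y' x'] assms S by (simp add: retract_rel_iff)
  moreover have "\<one> \<cdot> x \<cdot> y = \<one> \<cdot> x' \<cdot> y" using assms by (simp add: retract_rel_iff)
  ultimately show ?thesis
    using assms S by (simp add: retract_rel_iff idem_part_mult assoc)
qed

text \<open>The second argument is changed with \<open>x\<close> fixed; \<open>theta_cong\<close>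
  then replaces \<open>x\<close> by \<open>x'\<close> with equality.\<close>

lemma theta_retract_rel:
  assumes "(x, x') \<in> R" "(y, y') \<in> R" shows "(\<theta> x y, \<theta> x' y') \<in> R"
proof -
  have S: "x \<in> S" "x' \<in> S" "y \<in> S" "y' \<in> S" using assms by (auto simp: retract_rel_iff)
  let ?h = "idem_part y" and ?h' = "idem_part y'"
  have h: "?h \<in> E" "?h' \<in> E" using S idem_part by auto
  have "\<theta> (\<theta> x ?h) z = \<theta> (\<theta> x ?h') z" if z: "z \<in> S" for z
  proof -
    \<comment> \<open>On \<open>z = \<theta> x w\<close> the two sides become
      \<open>\<theta> ?h w\<close> and \<open>\<theta> ?h' w\<close>.\<close>
    obtain w where w: "w \<in> S" "z = \<theta> x w" using theta_surj[OF S(1) z] by blast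
    have "\<theta> ?h w = \<theta> ?h' w" using assms(2) w by (simp add: retract_rel_iff)
    then show ?thesis
      using theta_theta_idempotent[OF S(1) h(1) w(1)] theta_theta_idempotent[OF S(1) h(2) w(1)] w
      by simp
  qed
  moreover have "\<one> \<cdot> \<theta> x y = \<one> \<cdot> \<theta> x y'"
  proof -
    \<comment> \<open>The idempotent factor \<open>\<theta> x \<one>\<close> is absorbed, so the
      group component of \<open>\<theta> x z\<close> depends only on that of
      \<open>z\<close>.\<close>
    have *: "\<one> \<cdot> \<theta> x (\<one> \<cdot> z) = \<one> \<cdot> \<theta> x z" if "z \<in> S" for z
      using that theta_idempotent_mult[OF S(1) one_E that] theta_idempotent[OF S(1) one_E] S
      by (simp add: mult_idempotent flip: assoc)
    have "\<one> \<cdot> y = \<one> \<cdot> y'" using assms by (simp add: retract_rel_iff)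
    then show ?thesis using * S by metis
  qed
  ultimately have "(\<theta> x y, \<theta> x y') \<in> R"
    using S by (simp add: retract_rel_iff idem_part_theta)
  then show ?thesis using theta_cong[OF assms(1)] S by simp
qed

section \<open>The induced maps, idempotents and kernel of the retract\<close>

lemma retract_map_cls:
  assumes "x \<in> S" "y \<in> S"
  shows "pmult s' (cls x) (cls y) = cls (x \<cdot> y)" "theta s' (cls x) (cls y) = cls (\<theta> x y)"
proof -
  have "congruent2 R R (\<lambda>x y. cls (x \<cdot> y))" "congruent2 R R (\<lambda>x y. cls (\<theta> x y))"
    by (auto intro!: congruent2I' equiv_class_eq[OF equiv_retract_rel]
        mult_retract_rel theta_retract_rel)
  then show "pmult s' (cls x) (cls y) = cls (x \<cdot> y)" "theta s' (cls x) (cls y) = cls (\<theta> x y)"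
    using UN_equiv_class2[OF equiv_retract_rel equiv_retract_rel] assms
    unfolding pmult_def[of s'] theta_def[of s'] by (simp_all add: retract_map_def)
qed

lemma retract_set_eq: "S' = cls ` S"
  by (auto simp: retract_set_def quotient_def)

lemma idempotents_retract: "idempotents S' s' = cls ` E"
proof -
  \<comment> \<open>Related elements have equal group components, so an idempotent class contains
    only idempotents.\<close>
  have "x \<in> E" if "x \<in> S" "(x \<cdot> x, x) \<in> R" for x
  proof -
    have "idem_part x \<cdot> (x \<cdot> x) = idem_part x \<cdot> x"
        using that left_equivalent_cancel[of \<one> "x \<cdot> x" x "idem_part x"]
      by (simp add: retract_rel_iff)
    then show ?thesis
      using that idem_part by (simp add: idempotents_def flip: assoc)
  qed
  note idempotentI = this
  show ?thesis
  proof (intro subset_antisym subsetI)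
    fix X assume "X \<in> idempotents S' s'"
    then have X: "X \<in> S'" "pmult s' X X = X" by (simp_all add: idempotents_def)
    then obtain x where x: "x \<in> S" "X = cls x" unfolding retract_set_eq by blast
    then have "cls (x \<cdot> x) = cls x" using X retract_map_cls(1)[OF x(1) x(1)] by simp
    then have "(x \<cdot> x, x) \<in> R" using x(1) by (simp add: cls_eq_iff)
    then show "X \<in> cls ` E" using idempotentI x by blast
  next
    fix X assume "X \<in> cls ` E"
    then obtain e where e: "e \<in> E" "X = cls e" by blast
    then have "pmult s' X X = X" "X \<in> S'"
      using retract_map_cls(1)[OF E_in_S E_in_S, of e e] E_in_S E_idem by (auto simp: retract_set_eq)
    then show "X \<in> idempotents S' s'" by (simp add: idempotents_def)
  qed
qed

lemma retract_idempotent_eqI: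
  assumes "X \<in> idempotents S' s'" "Y \<in> idempotents S' s'"
    and eq: "\<And>Z. Z \<in> S' \<Longrightarrow> theta s' X Z = theta s' Y Z"
  shows "X = Y"
proof -
  obtain e f where ef: "e \<in> E" "f \<in> E" "X = cls e" "Y = cls f"
    using assms by (auto simp: idempotents_retract)
  note S = E_in_S[OF ef(1)] E_in_S[OF ef(2)]
  have idem: "idem_part h = h" if "h \<in> E" for h
    using that E_idem E_in_S by (intro idem_part_eqI) auto
  have "\<theta> e z = \<theta> f z" if z: "z \<in> S" for z
  proof -
    \<comment> \<open>The hypothesis is tested on the single class \<open>cls e\<close>.\<close>
    let ?a = "\<theta> e e" and ?b = "\<theta> f e"
    have ab: "?a \<in> E" "?b \<in> E" using theta_idempotent S ef by auto
    have "cls ?a = cls ?b"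
      using eq[of "cls e"] ef S by (simp add: retract_map_cls retract_set_eq)
    then have *: "\<theta> ?a w = \<theta> ?b w" if "w \<in> S" for w
      using that ab E_in_S idem by (simp add: cls_eq_iff retract_rel_iff)
    \<comment> \<open>Both sides equal \<open>\<theta> e z\<close>; on the left \<open>?b\<close>
      may be exchanged for \<open>?a\<close>.\<close>
    have "\<theta> ?b (\<theta> e z) = \<theta> ?b (\<theta> f z)"
      using theta_theta_idempotent[of e e z] theta_theta_idempotent[of f e z] S ef z *[of "\<theta> e z"]
      by simp
    then show ?thesis using theta_inj[of ?b "\<theta> e z" "\<theta> f z"] S z by simp
  qed
  then have "(e, f) \<in> R"
    using ef S one_E by (simp add: retract_rel_iff idem idempotent_left_zero)
  then show ?thesis using ef S by (simp add: cls_eq_iff)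
qed

text \<open>By \<open>theta_one\<close> the class of \<open>\<one>\<close> acts as the identity, and
  idempotent classes are determined by their action.\<close>

lemma ker_theta_retract: "ker_theta S' s' \<inter> idempotents S' s' = {cls \<one>}"
proof -
  have idem: "cls \<one> \<in> idempotents S' s'"
    using one_E by (simp add: idempotents_retract)
  have "theta s' (cls \<one>) Z = Z" if "Z \<in> S'" for Z
    using that unfolding retract_set_eq by (auto simp: retract_map_cls theta_one)
  then have ker: "cls \<one> \<in> ker_theta S' s'"
    using idem by (simp add: ker_theta_def idempotents_def)
  have "X = cls \<one>" if "X \<in> ker_theta S' s'" "X \<in> idempotents S' s'" for X
    using retract_idempotent_eqI[OF that(2) idem] that(1) ker by (simp add: ker_theta_def)
  then show ?thesis using idem ker by blast
qed

text \<open>Related classes share a group factor, and their idempotent factors act alike, hence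
  coincide. The base idempotent \<open>e1\<close> is arbitrary.\<close>

lemma irretractable_retract:
  assumes "e1 \<in> idempotents S' s'" shows "irretractable S' s' e1"
proof -
  obtain e where e: "e \<in> E" "e1 = cls e" using assms by (auto simp: idempotents_retract)
  define i where "i = \<theta> e e"
  have i: "i \<in> E" "i \<in> S" using e theta_idempotent E_in_S by (auto simp: i_def)
  have one': "base_one s' e1 = cls i"
    using e E_in_S by (simp add: base_one_def retract_map_cls i_def)
  have "(X, X) \<in> retract_rel S' s' e1" if X: "X \<in> S'" for X
  proof -
    obtain x where x: "x \<in> S" "X = cls x" using X by (auto simp: retract_set_eq)
    let ?h = "cls (idem_part x)" and ?g = "cls (i \<cdot> x)"
    \<comment> \<open>This factorisation relative to the new base \<open>i\<close> gives
      reflexivity.\<close>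
    have "idem_part x \<cdot> (i \<cdot> x) = x"
      using x i idem_part by (simp add: mult_idempotent flip: assoc)
    then have "X = pmult s' ?h ?g" using x i by (simp add: retract_map_cls)
    moreover have "?g \<in> base_group S' s' e1"
      unfolding base_group_def one'
    proof (rule image_eqI)
      show "?g = pmult s' (cls i) X" using x i by (simp add: retract_map_cls)
    qed (rule X)
    moreover have "?h \<in> idempotents S' s'" using x idem_part by (simp add: idempotents_retract)
    ultimately show ?thesis unfolding retract_rel_def[of S'] by blast
  qed
  moreover have "X = Y \<and> X \<in> S'" if XY: "(X, Y) \<in> retract_rel S' s' e1" for X Y
  proof -
    obtain A B G where A: "X = pmult s' A G" "Y = pmult s' B G" "A \<in> idempotents S' s'"
      "B \<in> idempotents S' s'" "G \<in> base_group S' s' e1" "\<forall>Z\<in>S'. theta s' A Z = theta s' B Z"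
      using XY unfolding retract_rel_def[of S'] by blast
    have AB: "A = B" using retract_idempotent_eqI[OF A(3,4)] A(6) by simp
    obtain Z where "Z \<in> S'" "G = pmult s' (cls i) Z"
      using A(5) unfolding base_group_def one' by blast
    then obtain z where z: "z \<in> S" "G = pmult s' (cls i) (cls z)"
      unfolding retract_set_eq by blast
    obtain a where a: "a \<in> S" "A = cls a"
      using A(3) E_in_S unfolding idempotents_retract by blast
    have "X = cls (a \<cdot> (i \<cdot> z))" using A(1) a z i by (simp add: retract_map_cls)
    moreover have "a \<cdot> (i \<cdot> z) \<in> S" using a z i by simp
    ultimately show ?thesis using A(1,2) AB unfolding retract_set_eq by blast
  qed
  ultimately show ?thesis unfolding irretractable_def by auto
qed

end

theorem proposition3p5:
  fixes S :: "'a set" and s :: "'a \<times> 'a \<Rightarrow> 'a \<times> 'a" and e0 :: 'a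
  assumes "finite_bijective_solution S s"
    and "e0 \<in> idempotents S s"
  defines "S' \<equiv> retract_set S s e0"
    and "s' \<equiv> retract_map S s e0"
  shows "card (ker_theta S' s' \<inter> idempotents S' s') = 1 \<and>
         (\<forall>e1 \<in> idempotents S' s'. irretractable S' s' e1)"
proof -
  interpret finite_pentagon_retract S s e0
    using assms(1,2) by unfold_locales
  show ?thesis
    unfolding S'_def s'_def using ker_theta_retract irretractable_retract by simp
qed

end
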